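(* Suppose that $\mathcal{A}$ and $\mathcal{B}$ are computable $(1,2)$-equivalence structures with universe $\omega$ such that the asymptotic densities of $\mathcal{A}(1)$ and $\mathcal{B}(1)$ both equal the same computable real $q$. Then $\mathcal{A}$ and $\mathcal{B}$ are weakly coarsely computably isomorphic.
   Context: An equivalence structure is a set with an equivalence relation on it; with universe $\omega$, it is computable if the equivalence relation is computable. A $(1,2)$-structure is an equivalence structure consisting of infinitely many classes of size 1 and infinitely many classes of size 2 (and no other classes). $\mathcal{A}(n)$ denotes the set of elements of $\mathcal{A}$ whose equivalence class has size $n$. A set $S\subseteq\omega$ has asymptotic density $\delta$ if $\lim_{n\to\infty} |S\cap\{0,\dots,n\}|/(n+1)=\delta$. Structures $\mathcal{A}$ and $\mathcal{B}$ with universe $\omega$ are weakly coarsely computably isomorphic if there are a set $C\subseteq\omega$ of asymptotic density one, a set isomorphism (i.e. a bijection of universes, not necessarily structure preserving) $f:\mathcal{A}\to\mathcal{B}$, and a total computable function $\theta$ such that: (i) $C$ is the universe of a substructure $\mathcal{C}$ of $\mathcal{A}$; (ii) $f(x)=\theta(x)$ for all $x\in C$; (iii) $f[C]$ has asymptotic density one; (iv) $\theta$ is an isomorphism from $\mathcal{C}$ to its image (as a substructure of $\mathcal{B}$). *)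

theory Defs
  imports Complex_Main
begin

section \<open>Computability\<close>

text \<open>Kleene's partial recursive functions. The value on \<open>xs\<close> of \<open>Prim f g\<close> recurses on the first
  argument; \<open>Mu f\<close> searches for the least first argument at which \<open>f\<close> vanishes. Arities are left
  implicit: a term is simply undefined on argument lists that do not fit, and \<open>Zero\<close> and \<open>Proj i\<close>
  stand for the constant and projection functions of every suitable arity.\<close>

datatype recf = Zero | Succ | Proj nat | Comp recf "recf list" | Prim recf recf | Mu recf

inductive eval :: "recf \<Rightarrow> nat list \<Rightarrow> nat \<Rightarrow> bool" where
  Zero: "eval Zero xs 0"
| Succ: "eval Succ [x] (Suc x)"
| Proj: "i < length xs \<Longrightarrow> eval (Proj i) xs (xs ! i)"
| Comp: "list_all2 (\<lambda>g y. eval g xs y) gs ys \<Longrightarrow> eval f ys z \<Longrightarrow> eval (Comp f gs) xs z"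
| Prim_0: "eval f xs y \<Longrightarrow> eval (Prim f g) (0 # xs) y"
| Prim_Suc: "eval (Prim f g) (n # xs) y \<Longrightarrow> eval g (n # y # xs) z
    \<Longrightarrow> eval (Prim f g) (Suc n # xs) z"
| Mu: "eval f (n # xs) 0 \<Longrightarrow> (\<forall>i<n. \<exists>y>0. eval f (i # xs) y) \<Longrightarrow> eval (Mu f) xs n"

inductive_cases eval_ZeroE: "eval Zero xs y"
inductive_cases eval_SuccE: "eval Succ xs y"
inductive_cases eval_ProjE: "eval (Proj i) xs y"
inductive_cases eval_CompE: "eval (Comp f gs) xs y"
inductive_cases eval_Prim_0E: "eval (Prim f g) (0 # xs) y"
inductive_cases eval_Prim_SucE: "eval (Prim f g) (Suc n # xs) y"
inductive_cases eval_MuE: "eval (Mu f) xs y"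

lemma eval_deterministic: "eval r xs y \<Longrightarrow> eval r xs z \<Longrightarrow> y = z"
proof (induction arbitrary: z rule: eval.induct)
  case (Zero xs)
  then show ?case by (rule eval_ZeroE) (rule sym)
next
  case (Succ x)
  from Succ.prems show ?case by (rule eval_SuccE) simp
next
  case (Proj i xs)
  from Proj.prems show ?case by (rule eval_ProjE) (rule sym)
next
  case (Comp xs gs ys f w)
  from Comp.prems obtain ys' where
    ys': "list_all2 (\<lambda>g y. eval g xs y) gs ys'" and f: "eval f ys' z"
    by (rule eval_CompE)
  have "ys = ys'"
  proof (rule nth_equalityI)
    show len: "length ys = length ys'"
      using list_all2_lengthD[OF Comp.IH(1)] list_all2_lengthD[OF ys'] by simp
    show "ys ! i = ys' ! i" if "i < length ys" for i
      using list_all2_nthD2[OF Comp.IH(1) that] list_all2_nthD2[OF ys', of i] that len by simp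
  qed
  with Comp.IH(2) f show ?case by blast
next
  case (Prim_0 f xs y g)
  from Prim_0.prems show ?case by (rule eval_Prim_0E) (rule Prim_0.IH)
next
  case (Prim_Suc f g n xs y w)
  from Prim_Suc.prems obtain y' where "eval (Prim f g) (n # xs) y'" "eval g (n # y' # xs) z"
    by (rule eval_Prim_SucE)
  with Prim_Suc.IH show ?case by blast
next
  case (Mu f n xs)
  from Mu.prems have "eval f (z # xs) 0 \<and> (\<forall>i<z. \<exists>y>0. eval f (i # xs) y)"
    by (rule eval_MuE) (rule conjI)
  then have 0: "eval f (z # xs) 0" and less: "\<forall>i<z. \<exists>y>0. eval f (i # xs) y"
    by (rule conjunct1, rule conjunct2)
  have "\<not> n < z" using Mu.IH(1) less by (metis less_irrefl)
  moreover have "\<not> z < n" using Mu.IH(2) 0 by (metis less_irrefl)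
  ultimately show ?case by linarith
qed

definition computable_fun :: "(nat \<Rightarrow> nat) \<Rightarrow> bool" where
  "computable_fun f \<longleftrightarrow> (\<exists>r. \<forall>x. eval r [x] (f x))"

definition computable_rel :: "(nat \<times> nat) set \<Rightarrow> bool" where
  "computable_rel E \<longleftrightarrow> (\<exists>r. \<forall>x y. eval r [x, y] (if (x, y) \<in> E then 1 else 0))"

text \<open>A real is computable if some computable sequence of rationals converges to it with error at
  most \<open>2\<^sup>-\<^sup>n\<close> at index \<open>n\<close>. The rationals are coded as \<open>(a - b) / (c + 1)\<close> with \<open>a, b, c\<close>
  natural numbers.\<close>

definition computable_real :: "real \<Rightarrow> bool" where
  "computable_real q \<longleftrightarrow> (\<exists>a b c. computable_fun a \<and> computable_fun b \<and> computable_fun c \<and>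
     (\<forall>n. \<bar>q - (real (a n) - real (b n)) / (real (c n) + 1)\<bar> \<le> (1 / 2) ^ n))"

section \<open>Asymptotic density\<close>

definition has_density :: "nat set \<Rightarrow> real \<Rightarrow> bool" where
  "has_density S \<delta> \<longleftrightarrow> (\<lambda>n. real (card (S \<inter> {0..n})) / (real n + 1)) \<longlonglongrightarrow> \<delta>"

section \<open>Equivalence structures with universe the natural numbers\<close>

text \<open>The structure is identified with its equivalence relation.\<close>

definition one_two_structure :: "(nat \<times> nat) set \<Rightarrow> bool" where
  "one_two_structure E \<longleftrightarrow> equiv UNIV E \<and>
     infinite {X \<in> UNIV // E. card X = 1} \<and>
     infinite {X \<in> UNIV // E. card X = 2} \<and>
     (\<forall>X \<in> UNIV // E. card X = 1 \<or> card X = 2)"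

text \<open>The finiteness condition only matters for \<open>n = 0\<close>, as \<open>card\<close> is \<open>0\<close> on infinite sets.\<close>

definition elements_of_class_size :: "(nat \<times> nat) set \<Rightarrow> nat \<Rightarrow> nat set" where
  "elements_of_class_size E n = {x. finite (E `` {x}) \<and> card (E `` {x}) = n}"

definition structure_iso ::
  "nat set \<Rightarrow> (nat \<times> nat) set \<Rightarrow> nat set \<Rightarrow> (nat \<times> nat) set \<Rightarrow> (nat \<Rightarrow> nat) \<Rightarrow> bool" where
  "structure_iso C R D S h \<longleftrightarrow> bij_betw h C D \<and>
     (\<forall>x\<in>C. \<forall>y\<in>C. (x, y) \<in> R \<longleftrightarrow> (h x, h y) \<in> S)"

text \<open>The language is relational, so every set \<open>C\<close> is the universe of a substructure, namely the
  one with relation \<open>Restr A C\<close>; no closure condition on \<open>C\<close> is needed. The set \<open>C\<close> and the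
  bijection \<open>f\<close> need not be computable.\<close>

definition weakly_coarsely_computably_isomorphic ::
  "(nat \<times> nat) set \<Rightarrow> (nat \<times> nat) set \<Rightarrow> bool" where
  "weakly_coarsely_computably_isomorphic A B \<longleftrightarrow>
     (\<exists>C f \<theta>. has_density C 1 \<and> bij f \<and> computable_fun \<theta> \<and>
        (\<forall>x\<in>C. f x = \<theta> x) \<and>
        has_density (f ` C) 1 \<and>
        structure_iso C (Restr A C) (\<theta> ` C) (Restr B (\<theta> ` C)) \<theta>)"

end

theory Submission
  imports Defs "HOL-Library.Nat_Bijection" "HOL-Library.Infinite_Set"
begin

text \<open>
  A structure \<open>A\<close> embeds computably into any infinite computable sequence of pairs (two-element
  classes) of \<open>B\<close>: the class with least element \<open>m\<close> goes into the pair with index \<open>m\<close>, its least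
  element to the smaller element of that pair and its other element, if there is one, to the larger.
  It need not be known in advance whether \<open>x\<close> is a singleton, since the second place of its pair is
  simply kept free; and the least element of the class of \<open>x\<close> is found by comparing \<open>x\<close> with the
  numbers below it. The sequence of pairs can be chosen so sparse that its set \<open>T\<close> of elements is
  computable and has density zero. This gives an embedding \<open>h\<close> of \<open>A\<close> into \<open>T\<close>.

  Symmetrically, \<open>B\<close> embeds into the set \<open>S\<close> of elements of a sparse sequence of pairs of \<open>A\<close>. As in
  the Cantor-Bernstein theorem, \<open>h\<close> outside \<open>S\<close> is to be combined with the inverse of an embedding \<open>g\<close>
  of \<open>B\<close> into \<open>S\<close>. Then \<open>C = - S \<union> g ` (- T)\<close> contains \<open>- S\<close> and its image contains \<open>- T\<close>, so both
  have density one. The inverse of \<open>g\<close> has to extend to a total computable function, however,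
  although \<open>g\<close> itself need not be computable. So \<open>g\<close> sends a class of \<open>B\<close> with least element \<open>a\<close> and
  greatest element \<open>b\<close> (equal for a singleton) into the pair of \<open>A\<close> whose index codes \<open>(a, b)\<close>. A pair
  of \<open>A\<close> with index \<open>k\<close> is then mapped back by decoding \<open>k\<close>, whether or not the
  two decoded numbers form a class of \<open>B\<close>. Many elements of \<open>S\<close> are mapped wrongly in this way, but
  these lie outside \<open>C\<close>, which is not required to be computable.

  The gluing is \<open>weakly_coarsely_computably_isomorphic_if_embeddings\<close>; both embeddings are instances
  of \<open>embed\<close>, applied with different ways of indexing the classes.
\<close>

section \<open>Closure properties of computable functions\<close>

text \<open>Binary functions suffice: the searches and recursions below have at most one parameter, and a
  unary function is a binary one that ignores its second argument.\<close>

definition computable_binary :: "(nat \<Rightarrow> nat \<Rightarrow> nat) \<Rightarrow> bool" where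
  "computable_binary F \<longleftrightarrow> (\<exists>r. \<forall>x y. eval r [x, y] (F x y))"

definition decidable_binary :: "(nat \<Rightarrow> nat \<Rightarrow> bool) \<Rightarrow> bool" where
  "decidable_binary P \<longleftrightarrow> computable_binary (\<lambda>x y. of_bool (P x y))"

lemma eval_const: "\<exists>r. \<forall>xs. eval r xs c"
proof (induction c)
  case 0
  then show ?case by (blast intro: eval.Zero)
next
  case (Suc c)
  then obtain r where "\<forall>xs. eval r xs c" by blast
  then have "eval (Comp Succ [r]) xs (Suc c)" for xs
    by (intro eval.Comp[where ys = "[c]"]) (auto intro: eval.Succ)
  then show ?case by blast
qed

lemma eval_Comp2:
  "eval g xs a \<Longrightarrow> eval h xs b \<Longrightarrow> eval f [a, b] z \<Longrightarrow> eval (Comp f [g, h]) xs z"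
  by (rule eval.Comp[where ys = "[a, b]"]) auto

lemma eval_Comp1: "eval g xs a \<Longrightarrow> eval f [a] z \<Longrightarrow> eval (Comp f [g]) xs z"
  by (rule eval.Comp[where ys = "[a]"]) auto

lemma eval_Comp3:
  "eval g xs a \<Longrightarrow> eval h xs b \<Longrightarrow> eval k xs c \<Longrightarrow> eval f [a, b, c] z \<Longrightarrow> eval (Comp f [g, h, k]) xs z"
  by (rule eval.Comp[where ys = "[a, b, c]"]) auto

lemma eval_Proj: "i < length xs \<Longrightarrow> xs ! i = y \<Longrightarrow> eval (Proj i) xs y"
  using eval.Proj by blast

lemma computable_binary_const: "computable_binary (\<lambda>x y. c)"
  using eval_const[of c] unfolding computable_binary_def by blast

lemma computable_binary_fst: "computable_binary (\<lambda>x y. x)"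
  unfolding computable_binary_def by (rule exI[where x = "Proj 0"]) (auto intro: eval_Proj)

lemma computable_binary_snd: "computable_binary (\<lambda>x y. y)"
  unfolding computable_binary_def by (rule exI[where x = "Proj 1"]) (auto intro: eval_Proj)

lemma computable_binary_apply:
  assumes "computable_fun f" and "computable_binary G"
  shows "computable_binary (\<lambda>x y. f (G x y))"
proof -
  from assms obtain r s where "\<forall>x. eval r [x] (f x)" and "\<forall>x y. eval s [x, y] (G x y)"
    unfolding computable_fun_def computable_binary_def by blast
  then have "\<forall>x y. eval (Comp r [s]) [x, y] (f (G x y))" by (blast intro: eval_Comp1)
  then show ?thesis unfolding computable_binary_def by blast
qed

lemma computable_binary_apply2:
  assumes "computable_binary F" and "computable_binary G" and "computable_binary H"
  shows "computable_binary (\<lambda>x y. F (G x y) (H x y))"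
proof -
  from assms obtain r s t where "\<forall>x y. eval r [x, y] (F x y)"
    and "\<forall>x y. eval s [x, y] (G x y)" and "\<forall>x y. eval t [x, y] (H x y)"
    unfolding computable_binary_def by blast
  then have "\<forall>x y. eval (Comp r [s, t]) [x, y] (F (G x y) (H x y))" by (blast intro: eval_Comp2)
  then show ?thesis unfolding computable_binary_def by blast
qed

lemma computable_fun_if_binary:
  assumes "computable_binary (\<lambda>x y. f x)"
  shows "computable_fun f"
proof -
  from assms obtain r where "\<forall>x y. eval r [x, y] (f x)"
    unfolding computable_binary_def by blast
  then have "\<forall>x. eval (Comp r [Proj 0, Proj 0]) [x] (f x)"
    by (auto intro!: eval_Comp2 intro: eval_Proj)
  then show ?thesis unfolding computable_fun_def by blast
qed

lemma computable_fun_Suc: "computable_fun Suc"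
  unfolding computable_fun_def by (blast intro: eval.Succ)

lemma computable_fun_rec_nat:
  assumes "computable_binary G"
  shows "computable_fun (rec_nat c G)"
proof -
  from assms obtain s where s: "\<forall>x y. eval s [x, y] (G x y)"
    unfolding computable_binary_def by blast
  obtain r where r: "\<forall>xs. eval r xs c" using eval_const by blast
  have "eval (Prim r s) [n] (rec_nat c G n)" for n
  proof (induction n)
    case 0
    show ?case using r by (auto intro: eval.Prim_0)
  next
    case (Suc n)
    then show ?case using s by (auto intro: eval.Prim_Suc)
  qed
  then show ?thesis unfolding computable_fun_def by blast
qed

lemma computable_binary_funpow:
  assumes "computable_fun f"
  shows "computable_binary (\<lambda>n y. (f ^^ n) y)"
proof -
  from assms obtain r where r: "\<forall>x. eval r [x] (f x)"
    unfolding computable_fun_def by blast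
  have "eval (Prim (Proj 0) (Comp r [Proj 1])) [n, y] ((f ^^ n) y)" for n y
  proof (induction n)
    case 0
    show ?case by (auto intro!: eval.Prim_0 eval_Proj)
  next
    case (Suc n)
    show ?case
    proof (rule eval.Prim_Suc[OF Suc])
      show "eval (Comp r [Proj 1]) [n, (f ^^ n) y, y] ((f ^^ Suc n) y)"
        using r by (auto intro!: eval_Comp1 eval_Proj)
    qed
  qed
  then show ?thesis unfolding computable_binary_def by blast
qed

lemma computable_binary_add:
  assumes "computable_binary F" and "computable_binary G"
  shows "computable_binary (\<lambda>x y. F x y + G x y)"
proof -
  have "computable_binary (\<lambda>n y. n + y)"
    using computable_binary_funpow[OF computable_fun_Suc] by simp
  from computable_binary_apply2[OF this assms] show ?thesis .
qed

lemma computable_binary_diff: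
  assumes "computable_binary F" and "computable_binary G"
  shows "computable_binary (\<lambda>x y. F x y - G x y)"
proof -
  have "rec_nat 0 (\<lambda>k y. k) = (\<lambda>n. n - 1)"
  proof
    show "rec_nat 0 (\<lambda>k y. k) n = n - 1" for n by (cases n) auto
  qed
  then have "computable_fun (\<lambda>n. n - 1)"
    using computable_fun_rec_nat[OF computable_binary_fst, of 0] by simp
  moreover have "((\<lambda>n. n - 1) ^^ n) y = y - n" for n y :: nat
    by (induction n) auto
  ultimately have "computable_binary (\<lambda>n y. y - n)"
    using computable_binary_funpow[of "\<lambda>n. n - 1"] by simp
  from computable_binary_apply2[OF this assms(2,1)] show ?thesis .
qed

lemma decidable_binary_le:
  assumes "computable_binary F" and "computable_binary G"
  shows "decidable_binary (\<lambda>x y. F x y \<le> G x y)"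
proof -
  have "computable_binary (\<lambda>x y. 1 - (F x y - G x y))"
    by (intro computable_binary_diff computable_binary_const assms)
  moreover have "(\<lambda>x y. 1 - (F x y - G x y)) = (\<lambda>x y. of_bool (F x y \<le> G x y))"
    by (auto simp: fun_eq_iff of_bool_def)
  ultimately show ?thesis unfolding decidable_binary_def by simp
qed

lemma decidable_binary_not:
  assumes "decidable_binary P"
  shows "decidable_binary (\<lambda>x y. \<not> P x y)"
proof -
  have "computable_binary (\<lambda>x y. 1 - of_bool (P x y))"
    using assms unfolding decidable_binary_def
    by (intro computable_binary_diff computable_binary_const)
  moreover have "(\<lambda>x y. 1 - of_bool (P x y)) = (\<lambda>x y. of_bool (\<not> P x y) :: nat)"
    by (auto simp: fun_eq_iff)
  ultimately show ?thesis unfolding decidable_binary_def by simp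
qed

lemma decidable_binary_conj:
  assumes "decidable_binary P" and "decidable_binary Q"
  shows "decidable_binary (\<lambda>x y. P x y \<and> Q x y)"
proof -
  have "computable_binary (\<lambda>x y. of_bool (P x y) - of_bool (\<not> Q x y))"
    using assms(1) decidable_binary_not[OF assms(2)] unfolding decidable_binary_def
    by (intro computable_binary_diff)
  moreover have "(\<lambda>x y. of_bool (P x y) - of_bool (\<not> Q x y))
      = (\<lambda>x y. of_bool (P x y \<and> Q x y) :: nat)"
    by (auto simp: fun_eq_iff)
  ultimately show ?thesis unfolding decidable_binary_def by simp
qed

lemma decidable_binary_disj:
  assumes "decidable_binary P" and "decidable_binary Q"
  shows "decidable_binary (\<lambda>x y. P x y \<or> Q x y)"
  using decidable_binary_not[OF decidable_binary_conj[OF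
        decidable_binary_not[OF assms(1)] decidable_binary_not[OF assms(2)]]]
  by simp

lemma decidable_binary_less:
  assumes "computable_binary F" and "computable_binary G"
  shows "decidable_binary (\<lambda>x y. F x y < G x y)"
  using decidable_binary_not[OF decidable_binary_le[OF assms(2,1)]] by (simp add: not_le)

lemma decidable_binary_eq:
  assumes "computable_binary F" and "computable_binary G"
  shows "decidable_binary (\<lambda>x y. F x y = G x y)"
  using decidable_binary_conj[OF decidable_binary_le[OF assms] decidable_binary_le[OF assms(2,1)]]
  by (simp add: eq_iff)

text \<open>Primitive recursion on the truth value of \<open>P\<close> gives the case distinction: the base case
  computes \<open>G\<close>, and the step from 0 to 1 discards the recursive value and computes \<open>F\<close>.\<close>

lemma computable_binary_if:
  assumes "decidable_binary P" and "computable_binary F" and "computable_binary G"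
  shows "computable_binary (\<lambda>x y. if P x y then F x y else G x y)"
proof -
  from assms obtain p r s where p: "\<forall>x y. eval p [x, y] (of_bool (P x y))"
    and r: "\<forall>x y. eval r [x, y] (F x y)" and s: "\<forall>x y. eval s [x, y] (G x y)"
    unfolding computable_binary_def decidable_binary_def by blast
  define d where "d = Prim s (Comp r [Proj 2, Proj 3])"
  have 0: "eval d [0, x, y] (G x y)" for x y
    unfolding d_def using s by (auto intro: eval.Prim_0)
  have 1: "eval d [Suc 0, x, y] (F x y)" for x y
    unfolding d_def
    by (rule eval.Prim_Suc[OF 0[unfolded d_def]])
      (use r in \<open>auto intro!: eval_Comp2 eval_Proj\<close>)
  have "eval (Comp d [p, Proj 0, Proj 1]) [x, y] (if P x y then F x y else G x y)" for x y
  proof (rule eval_Comp3)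
    show "eval p [x, y] (of_bool (P x y))" using p by blast
    show "eval (Proj 0) [x, y] x" "eval (Proj 1) [x, y] y" by (auto intro: eval_Proj)
    show "eval d [of_bool (P x y), x, y] (if P x y then F x y else G x y)"
      using 0 1 by simp
  qed
  then show ?thesis unfolding computable_binary_def by blast
qed

lemma computable_fun_Least:
  assumes "decidable_binary P" and ex: "\<And>x. \<exists>i. P i x"
  shows "computable_fun (\<lambda>x. LEAST i. P i x)"
proof -
  from decidable_binary_not[OF assms(1)]
  obtain r where r: "\<And>i x. eval r [i, x] (of_bool (\<not> P i x))"
    unfolding decidable_binary_def computable_binary_def by blast
  have "eval (Mu r) [x] (LEAST i. P i x)" for x
  proof (rule eval.Mu)
    show "eval r [LEAST i. P i x, x] 0"
      using r[of "LEAST i. P i x" x] LeastI_ex[OF ex[of x]] by simp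
    show "\<forall>j < (LEAST i. P i x). \<exists>y>0. eval r [j, x] y"
    proof (intro allI impI)
      fix j assume "j < (LEAST i. P i x)"
      then have "\<not> P j x" by (rule not_less_Least)
      then have "eval r [j, x] 1" using r[of j x] by simp
      then show "\<exists>y>0. eval r [j, x] y" by (intro exI[where x = 1]) simp
    qed
  qed
  then show ?thesis unfolding computable_fun_def by blast
qed

lemma decidable_binary_if_computable_rel:
  "computable_rel E \<Longrightarrow> decidable_binary (\<lambda>x y. (x, y) \<in> E)"
  unfolding computable_rel_def decidable_binary_def computable_binary_def
  by (simp add: of_bool_def)

lemmas computable_intros =
  computable_binary_const computable_binary_fst computable_binary_snd
  computable_binary_add computable_binary_diff computable_binary_if
  decidable_binary_le decidable_binary_less decidable_binary_eq
  decidable_binary_not decidable_binary_conj decidable_binary_disj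


section \<open>A computable listing of all pairs\<close>

text \<open>The index \<open>triangle b + a\<close> codes the pair \<open>a \<le> b\<close>. The larger coordinate determines the block
  from \<open>triangle b\<close> up to, but excluding, \<open>triangle (Suc b)\<close>, and the smaller one the position within
  it.\<close>

definition larger_coordinate :: "nat \<Rightarrow> nat" where
  "larger_coordinate k = (LEAST b. k < triangle (Suc b))"

definition smaller_coordinate :: "nat \<Rightarrow> nat" where
  "smaller_coordinate k = k - triangle (larger_coordinate k)"

lemma triangle_mono: "m \<le> n \<Longrightarrow> triangle m \<le> triangle n"
  by (rule lift_Suc_mono_le[of triangle]) auto

lemma larger_coordinate_triangle: "a \<le> b \<Longrightarrow> larger_coordinate (triangle b + a) = b"
  unfolding larger_coordinate_def
proof (rule Least_equality)
  assume "a \<le> b"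
  then show "triangle b + a < triangle (Suc b)" by simp
  show "b \<le> c" if "triangle b + a < triangle (Suc c)" for c
  proof (rule ccontr)
    assume "\<not> b \<le> c"
    then have "triangle (Suc c) \<le> triangle b" by (intro triangle_mono) simp
    with that show False by simp
  qed
qed

lemma smaller_coordinate_triangle: "a \<le> b \<Longrightarrow> smaller_coordinate (triangle b + a) = a"
  by (simp add: smaller_coordinate_def larger_coordinate_triangle)

lemma computable_fun_triangle: "computable_fun triangle"
proof -
  have "triangle = rec_nat 0 (\<lambda>k y. y + (k + 1))"
  proof
    show "triangle n = rec_nat 0 (\<lambda>k y. y + (k + 1)) n" for n by (induction n) auto
  qed
  moreover have "computable_fun (rec_nat 0 (\<lambda>k y. y + (k + 1)))"
    by (intro computable_fun_rec_nat computable_intros)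
  ultimately show ?thesis by simp
qed

lemma computable_fun_larger_coordinate: "computable_fun larger_coordinate"
proof -
  have ex: "\<exists>b. k < triangle (Suc b)" for k
    by (rule exI[where x = k]) simp
  have "decidable_binary (\<lambda>b k. k < triangle (b + 1))"
    by (intro computable_intros computable_binary_apply[OF computable_fun_triangle])
  then have "computable_fun (\<lambda>k. LEAST b. k < triangle (Suc b))"
    using ex by (intro computable_fun_Least) simp_all
  then show ?thesis unfolding larger_coordinate_def[abs_def] .
qed

lemma computable_fun_smaller_coordinate: "computable_fun smaller_coordinate"
  unfolding smaller_coordinate_def[abs_def]
  by (intro computable_fun_if_binary computable_intros
      computable_binary_apply[OF computable_fun_triangle]
      computable_binary_apply[OF computable_fun_larger_coordinate])


section \<open>A sparse computable sequence of two-element classes\<close>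

definition class_min :: "(nat \<times> nat) set \<Rightarrow> nat \<Rightarrow> nat" where
  "class_min E x = (LEAST y. (y, x) \<in> E)"

definition next_pair :: "(nat \<times> nat) set \<Rightarrow> nat \<Rightarrow> nat" where
  "next_pair E n = (LEAST v. n \<le> class_min E v \<and> class_min E v < v)"

text \<open>Starting the next search at distance \<open>2 k + 1\<close> beyond the current pair makes the sequence grow
  at least like \<open>k\<^sup>2\<close>.\<close>

definition upper :: "(nat \<times> nat) set \<Rightarrow> nat \<Rightarrow> nat" where
  "upper E = rec_nat (next_pair E 0) (\<lambda>k v. next_pair E (v + (k + k + 1)))"

definition lower :: "(nat \<times> nat) set \<Rightarrow> nat \<Rightarrow> nat" where
  "lower E k = class_min E (upper E k)"

definition sparse_part :: "(nat \<times> nat) set \<Rightarrow> nat set" where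
  "sparse_part E = range (lower E) \<union> range (upper E)"

text \<open>The disjunct \<open>x < k\<close> stops the search on every argument. An index is never larger than an
  element of its pair, so the value exceeds \<open>x\<close> exactly if \<open>x\<close> lies in no pair.\<close>

definition pair_index :: "(nat \<times> nat) set \<Rightarrow> nat \<Rightarrow> nat" where
  "pair_index E x = (LEAST k. lower E k = x \<or> upper E k = x \<or> x < k)"

locale one_two =
  fixes E :: "(nat \<times> nat) set"
  assumes one_two: "one_two_structure E"
begin

lemma equiv: "equiv UNIV E"
  using one_two unfolding one_two_structure_def by blast

lemma refl: "(x, x) \<in> E"
  using equiv unfolding equiv_def refl_on_def by blast

lemma sym: "(x, y) \<in> E \<Longrightarrow> (y, x) \<in> E"
  using equiv unfolding equiv_def sym_def by blast

lemma trans: "(x, y) \<in> E \<Longrightarrow> (y, z) \<in> E \<Longrightarrow> (x, z) \<in> E"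
  using equiv unfolding equiv_def trans_def by blast

lemma card_class: "card (E `` {x}) = 1 \<or> card (E `` {x}) = 2"
  using one_two quotientI[of x UNIV E] unfolding one_two_structure_def by blast

lemma finite_class: "finite (E `` {x})"
  using card_class[of x] by (metis card.infinite zero_neq_one zero_neq_numeral)

lemma at_most_two:
  assumes "(x, y) \<in> E" and "(x, z) \<in> E"
  shows "x = y \<or> x = z \<or> y = z"
proof (rule ccontr)
  assume "\<not> ?thesis"
  then have "card {x, y, z} = 3" by auto
  moreover have "card {x, y, z} \<le> card (E `` {x})"
    using assms refl finite_class by (intro card_mono) auto
  ultimately show False using card_class[of x] by auto
qed

lemma class_min_related: "(class_min E x, x) \<in> E"
  unfolding class_min_def by (rule LeastI[where k = x]) (rule refl)

lemma class_min_le: "(y, x) \<in> E \<Longrightarrow> class_min E x \<le> y"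
  unfolding class_min_def by (rule Least_le)

lemma class_min_eq_iff: "class_min E x = class_min E y \<longleftrightarrow> (x, y) \<in> E"
proof
  assume "class_min E x = class_min E y"
  then show "(x, y) \<in> E" using class_min_related sym trans by metis
next
  assume "(x, y) \<in> E"
  then have "(z, x) \<in> E \<longleftrightarrow> (z, y) \<in> E" for z using sym trans by blast
  then show "class_min E x = class_min E y" unfolding class_min_def by simp
qed

lemma infinite_upper_elements: "infinite {v. class_min E v < v}"
proof
  let ?V = "{v. class_min E v < v}"
  assume fin: "finite ?V"
  have "{X \<in> UNIV // E. card X = 2} \<subseteq> (\<lambda>v. E `` {v}) ` ?V"
  proof
    fix X assume "X \<in> {X \<in> UNIV // E. card X = 2}"
    then obtain x where X: "X = E `` {x}" and "card X = 2" by (auto elim: quotientE)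
    then obtain a b where "X = {a, b}" "a \<noteq> b" by (meson card_2_iff)
    then obtain a b where ab: "X = {a, b}" "a < b"
      by (metis insert_commute nat_neq_iff)
    then have "(x, a) \<in> E" "(x, b) \<in> E" using X by auto
    then have "(a, b) \<in> E" using sym trans by blast
    then have "class_min E b < b" using class_min_le ab(2) by (meson le_less_trans)
    moreover have "X = E `` {b}" using X \<open>(x, b) \<in> E\<close> sym trans by blast
    ultimately show "X \<in> (\<lambda>v. E `` {v}) ` ?V" by blast
  qed
  then have "finite {X \<in> UNIV // E. card X = 2}" using fin by (meson finite_surj)
  then show False using one_two unfolding one_two_structure_def by blast
qed

text \<open>A pair is determined by its smaller element, so infinitely many pairs have unboundedly large
  smaller elements. This is what makes the search for the next pair total.\<close>

lemma pair_beyond: "\<exists>v. n \<le> class_min E v \<and> class_min E v < v"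
proof (rule ccontr)
  assume "\<not> ?thesis"
  then have below: "class_min E v < n" if "class_min E v < v" for v using that by force
  have "inj_on (class_min E) {v. class_min E v < v}"
  proof (rule inj_onI)
    fix v w assume vw: "v \<in> {v. class_min E v < v}" "w \<in> {v. class_min E v < v}"
      and eq: "class_min E v = class_min E w"
    have "(class_min E v, v) \<in> E" "(class_min E v, w) \<in> E"
      using class_min_related[of v] class_min_related[of w] eq by auto
    from at_most_two[OF this] show "v = w" using vw eq by auto
  qed
  moreover have "class_min E ` {v. class_min E v < v} \<subseteq> {..<n}" using below by auto
  ultimately have "finite {v. class_min E v < v}"
    by (meson finite_imageD finite_lessThan finite_subset)
  with infinite_upper_elements show False by blast
qed

lemma next_pair: "n \<le> class_min E (next_pair E n)" "class_min E (next_pair E n) < next_pair E n"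
  using LeastI_ex[OF pair_beyond[of n]] unfolding next_pair_def by blast+

lemma lower_less_upper: "lower E k < upper E k"
  unfolding lower_def upper_def by (cases k) (simp_all add: next_pair)

lemma lower_upper_related: "(lower E k, upper E k) \<in> E"
  unfolding lower_def by (rule class_min_related)

lemma gap: "upper E k + (k + k + 1) \<le> lower E (Suc k)"
  unfolding lower_def upper_def by (simp add: next_pair(1) del: add_Suc_right)

lemma square_le_lower: "k * k \<le> lower E k"
proof (induction k)
  case 0
  show ?case by simp
next
  case (Suc k)
  then show ?case using gap[of k] lower_less_upper[of k] by simp
qed

lemma upper_less_lower:
  assumes "j < k"
  shows "upper E j < lower E k"
  using assms
proof (induction k)
  case (Suc k)
  then consider "j = k" | "j < k" by linarith
  then show ?case using Suc.IH gap[of k] lower_less_upper[of k] by cases auto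
qed simp

lemma index_le: "x \<in> {lower E k, upper E k} \<Longrightarrow> k \<le> x"
  using le_trans[OF le_square square_le_lower[of k]] lower_less_upper[of k] by auto

text \<open>Distinct pairs of the sequence occupy disjoint intervals, so an element determines its pair.\<close>

lemma index_unique:
  assumes "x \<in> {lower E j, upper E j}" and "x \<in> {lower E k, upper E k}"
  shows "j = k"
  using assms upper_less_lower[of j k] upper_less_lower[of k j]
    lower_less_upper[of j] lower_less_upper[of k]
  by (cases j k rule: linorder_cases) auto

lemma related_to_pair:
  assumes "x \<in> {lower E k, upper E k}"
  shows "(x, y) \<in> E \<longleftrightarrow> y \<in> {lower E k, upper E k}"
proof
  assume xy: "(x, y) \<in> E"
  have "(lower E k, x) \<in> E" using assms refl lower_upper_related by auto
  then have "(lower E k, y) \<in> E" using xy trans by blast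
  from at_most_two[OF lower_upper_related this]
  show "y \<in> {lower E k, upper E k}" using lower_less_upper[of k] by auto
next
  assume "y \<in> {lower E k, upper E k}"
  then show "(x, y) \<in> E" using assms refl lower_upper_related sym by auto
qed

lemma sparse_part_iff: "x \<in> sparse_part E \<longleftrightarrow> (\<exists>k. x \<in> {lower E k, upper E k})"
  unfolding sparse_part_def by auto

lemma sparse_part_closed: "x \<in> sparse_part E \<Longrightarrow> (x, y) \<in> E \<Longrightarrow> y \<in> sparse_part E"
  unfolding sparse_part_iff using related_to_pair by blast

text \<open>Since the elements of the pair with index \<open>k\<close> are at least \<open>k\<^sup>2\<close>, there are at most
  \<open>2 (\<surd>n + 1)\<close> elements of the sparse part up to \<open>n\<close>.\<close>

lemma sparse_part_density: "has_density (sparse_part E) 0"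
proof -
  let ?c = "\<lambda>n. real (card (sparse_part E \<inter> {0..n}))"
  have bound: "?c n / (real n + 1) \<le> 4 * inverse (sqrt (real (Suc n)))" for n
  proof -
    define K where "K = {k. k * k \<le> n}"
    have K: "k \<le> nat \<lfloor>sqrt (real n)\<rfloor>" if "k \<in> K" for k
    proof -
      have "real k * real k \<le> real n" using that unfolding K_def
        by (metis mem_Collect_eq of_nat_le_iff of_nat_mult)
      then have "real k \<le> sqrt (real n)" by (simp add: real_le_rsqrt power2_eq_square)
      then show ?thesis by (simp add: le_nat_floor)
    qed
    then have "K \<subseteq> {..nat \<lfloor>sqrt (real n)\<rfloor>}" by auto
    then have fin: "finite K" and "card K \<le> Suc (nat \<lfloor>sqrt (real n)\<rfloor>)"
      using finite_subset card_mono[of "{..nat \<lfloor>sqrt (real n)\<rfloor>}" K] by auto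
    then have "real (card K) \<le> sqrt (real n) + 1"
      using of_nat_floor[OF real_sqrt_ge_zero[of "real n"]] by linarith
    also have "\<dots> \<le> 2 * sqrt (real (Suc n))"
      using real_sqrt_le_mono[of "real n" "real (Suc n)"] real_sqrt_ge_one[of "real (Suc n)"]
      by linarith
    finally have cardK: "real (card K) \<le> 2 * sqrt (real (Suc n))" .
    have "sparse_part E \<inter> {0..n} \<subseteq> lower E ` K \<union> upper E ` K"
    proof
      fix x assume x: "x \<in> sparse_part E \<inter> {0..n}"
      then obtain k where k: "x \<in> {lower E k, upper E k}"
        using sparse_part_iff by blast
      then have "k * k \<le> x" using square_le_lower[of k] lower_less_upper[of k] by auto
      then have "k \<in> K" using x unfolding K_def by auto
      then show "x \<in> lower E ` K \<union> upper E ` K" using k by auto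
    qed
    then have "card (sparse_part E \<inter> {0..n}) \<le> card (lower E ` K \<union> upper E ` K)"
      using fin by (intro card_mono) auto
    also have "\<dots> \<le> card K + card K"
      using card_Un_le[of "lower E ` K" "upper E ` K"] card_image_le[OF fin, of "lower E"]
        card_image_le[OF fin, of "upper E"] by linarith
    finally have "?c n \<le> 4 * sqrt (real (Suc n))" using cardK by linarith
    then have "?c n / (real n + 1) \<le> 4 * sqrt (real (Suc n)) / real (Suc n)"
      by (intro frac_le) auto
    also have "\<dots> = 4 * inverse (sqrt (real (Suc n)))"
      using real_sqrt_mult_self[of "real (Suc n)"] by (simp add: field_simps del: real_sqrt_mult_self)
    finally show ?thesis .
  qed
  have "filterlim (\<lambda>n. sqrt (real (Suc n))) at_top sequentially"
    by (rule filterlim_compose[OF sqrt_at_top])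
      (rule filterlim_compose[OF filterlim_real_sequentially filterlim_Suc])
  then have "(\<lambda>n. 4 * inverse (sqrt (real (Suc n)))) \<longlonglongrightarrow> 4 * 0"
    by (intro tendsto_mult tendsto_const tendsto_inverse_0_at_top)
  then have "(\<lambda>n. 4 * inverse (sqrt (real (Suc n)))) \<longlonglongrightarrow> 0" by simp
  from tendsto_sandwich[OF _ _ tendsto_const this]
  show ?thesis unfolding has_density_def using bound by simp
qed

lemma pair_index:
  assumes "x \<in> {lower E k, upper E k}"
  shows "pair_index E x = k"
  unfolding pair_index_def
proof (rule Least_equality)
  show "lower E k = x \<or> upper E k = x \<or> x < k" using assms by auto
  show "k \<le> j" if "lower E j = x \<or> upper E j = x \<or> x < j" for j
    using that index_unique[OF assms, of j] index_le[OF assms] by auto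
qed

lemma pair_index_le_iff: "pair_index E x \<le> x \<longleftrightarrow> x \<in> sparse_part E"
proof
  have "\<exists>k. lower E k = x \<or> upper E k = x \<or> x < k" by blast
  from LeastI_ex[OF this]
  show "x \<in> sparse_part E" if "pair_index E x \<le> x"
    using that unfolding sparse_part_iff pair_index_def insert_iff by (metis not_less)
next
  assume "x \<in> sparse_part E"
  then obtain k where k: "x \<in> {lower E k, upper E k}" unfolding sparse_part_iff by blast
  then show "pair_index E x \<le> x" using pair_index[OF k] index_le[OF k] by simp
qed

lemma computable_fun_class_min:
  assumes "computable_rel E"
  shows "computable_fun (class_min E)"
  unfolding class_min_def[abs_def]
  using refl by (intro computable_fun_Least decidable_binary_if_computable_rel[OF assms]) blast

lemma computable_fun_upper:
  assumes "computable_rel E"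
  shows "computable_fun (upper E)"
proof -
  have "computable_fun (next_pair E)"
    unfolding next_pair_def[abs_def]
    by (intro computable_fun_Least computable_intros pair_beyond
        computable_binary_apply[OF computable_fun_class_min[OF assms]])
  then show ?thesis unfolding upper_def
    by (intro computable_fun_rec_nat computable_intros computable_binary_apply[of "next_pair E"])
qed

lemma computable_fun_lower:
  assumes "computable_rel E"
  shows "computable_fun (lower E)"
  unfolding lower_def[abs_def]
  by (intro computable_fun_if_binary computable_intros
      computable_binary_apply[OF computable_fun_class_min[OF assms]]
      computable_binary_apply[OF computable_fun_upper[OF assms]])

lemma computable_fun_pair_index:
  assumes "computable_rel E"
  shows "computable_fun (pair_index E)"
  unfolding pair_index_def[abs_def]
proof (rule computable_fun_Least)
  show "decidable_binary (\<lambda>k x. lower E k = x \<or> upper E k = x \<or> x < k)"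
    by (intro computable_intros computable_binary_apply[OF computable_fun_lower[OF assms]]
      computable_binary_apply[OF computable_fun_upper[OF assms]])
qed blast

text \<open>The code of a class depends on its greatest element, which in general cannot be computed from \<open>x\<close>. Only
  decoding has to be computable.\<close>

definition pair_code :: "nat \<Rightarrow> nat" where
  "pair_code x = triangle (Max (E `` {x})) + class_min E x"

lemma class_min_le_Max: "class_min E x \<le> Max (E `` {x})"
  using class_min_related sym finite_class by (intro Max_ge) auto

lemma smaller_coordinate_pair_code: "smaller_coordinate (pair_code x) = class_min E x"
  unfolding pair_code_def by (rule smaller_coordinate_triangle) (rule class_min_le_Max)

lemma larger_coordinate_pair_code:
  assumes "class_min E x \<noteq> x"
  shows "larger_coordinate (pair_code x) = x"
proof -
  have less: "class_min E x < x" using assms class_min_le[OF refl, of x] by simp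
  have "y \<le> x" if "(x, y) \<in> E" for y
    using at_most_two[OF that sym[OF class_min_related]] assms less by auto
  then have "Max (E `` {x}) = x" using refl finite_class by (intro Max_eqI) auto
  then show ?thesis
    using larger_coordinate_triangle[OF class_min_le_Max[of x]] unfolding pair_code_def by simp
qed

lemma pair_code_eq_iff: "pair_code x = pair_code y \<longleftrightarrow> (x, y) \<in> E"
proof
  assume "pair_code x = pair_code y"
  then show "(x, y) \<in> E"
    using smaller_coordinate_pair_code class_min_eq_iff by metis
next
  assume "(x, y) \<in> E"
  then have "E `` {x} = E `` {y}" "class_min E x = class_min E y"
    using equiv class_min_eq_iff by (auto simp: equiv_class_eq)
  then show "pair_code x = pair_code y" unfolding pair_code_def by simp
qed

end


section \<open>Embedding a structure into sparsely many classes of another\<close>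

text \<open>The index function \<open>c\<close> names the pair of \<open>S\<close> that receives the class of \<open>x\<close>. It has to be
  constant on the classes of \<open>R\<close> and to separate them.\<close>

definition embed ::
  "(nat \<times> nat) set \<Rightarrow> (nat \<times> nat) set \<Rightarrow> (nat \<Rightarrow> nat) \<Rightarrow> nat \<Rightarrow> nat" where
  "embed R S c x = (if class_min R x = x then lower S (c x) else upper S (c x))"

lemma embed_in_pair: "embed R S c x \<in> {lower S (c x), upper S (c x)}"
  unfolding embed_def by simp

lemma embed_in_sparse_part: "embed R S c x \<in> sparse_part S"
  unfolding embed_def sparse_part_def by simp

context
  fixes R S :: "(nat \<times> nat) set" and c :: "nat \<Rightarrow> nat"
  assumes R: "one_two_structure R" and S: "one_two_structure S"
    and c: "\<And>x y. c x = c y \<longleftrightarrow> (x, y) \<in> R"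
begin

interpretation R: one_two R by unfold_locales (rule R)
interpretation S: one_two S by unfold_locales (rule S)

lemma embed_related_iff: "(embed R S c x, embed R S c y) \<in> S \<longleftrightarrow> (x, y) \<in> R"
proof -
  have "(embed R S c x, embed R S c y) \<in> S \<longleftrightarrow> embed R S c y \<in> {lower S (c x), upper S (c x)}"
    using S.related_to_pair[OF embed_in_pair] .
  also have "\<dots> \<longleftrightarrow> c x = c y"
    using S.index_unique[OF _ embed_in_pair] embed_in_pair by metis
  finally show ?thesis using c by simp
qed

lemma inj_embed: "inj (embed R S c)"
proof (rule injI)
  fix x y assume eq: "embed R S c x = embed R S c y"
  then have xy: "(x, y) \<in> R" using embed_related_iff S.refl by metis
  then have cxy: "c x = c y" and min: "class_min R x = class_min R y"
    using c R.class_min_eq_iff by auto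
  have "class_min R x = x \<longleftrightarrow> class_min R y = y"
    using eq cxy S.lower_less_upper[of "c x"] unfolding embed_def by (auto split: if_splits)
  moreover have "(class_min R x, x) \<in> R" "(class_min R x, y) \<in> R"
    using R.class_min_related min by metis+
  ultimately show "x = y" using R.at_most_two min by metis
qed

end


section \<open>Gluing two embeddings\<close>

lemma has_density_one:
  assumes "has_density S 0" and "- S \<subseteq> C"
  shows "has_density C 1"
proof -
  let ?d = "\<lambda>T n. real (card (T \<inter> {0..n})) / (real n + 1)"
  have lb: "1 - ?d S n \<le> ?d C n" for n
  proof -
    have "{0..n} \<subseteq> (S \<inter> {0..n}) \<union> (C \<inter> {0..n})" using assms(2) by auto
    then have "card {0..n} \<le> card ((S \<inter> {0..n}) \<union> (C \<inter> {0..n}))" by (intro card_mono) auto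
    also have "\<dots> \<le> card (S \<inter> {0..n}) + card (C \<inter> {0..n})" by (rule card_Un_le)
    finally have "real n + 1 \<le> real (card (S \<inter> {0..n})) + real (card (C \<inter> {0..n}))" by simp
    then have "1 \<le> ?d S n + ?d C n"
      by (simp flip: add_divide_distrib add: le_divide_eq)
    then show ?thesis by simp
  qed
  have ub: "?d C n \<le> 1" for n
  proof -
    have "card (C \<inter> {0..n}) \<le> card {0..n}" by (intro card_mono) auto
    then show ?thesis by (simp add: field_simps)
  qed
  have "(\<lambda>n. 1 - ?d S n) \<longlonglongrightarrow> 1 - 0"
    using assms(1) unfolding has_density_def by (intro tendsto_diff tendsto_const)
  then have "(\<lambda>n. 1 - ?d S n) \<longlonglongrightarrow> 1" by simp
  from tendsto_sandwich[OF _ _ this tendsto_const[of 1]]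
  show ?thesis unfolding has_density_def using lb ub by simp
qed

text \<open>The two complements are infinite subsets of the natural numbers, hence equipotent.\<close>

lemma inj_on_extends_to_bij:
  fixes \<theta> :: "nat \<Rightarrow> nat"
  assumes "inj_on \<theta> C" and "infinite (- C)" and "infinite (- \<theta> ` C)"
  shows "\<exists>f. bij f \<and> (\<forall>x\<in>C. f x = \<theta> x)"
proof -
  obtain e where e: "bij_betw e (- C) (- \<theta> ` C)"
    using bij_betw_trans[OF bij_betw_inv_into[OF bij_enumerate[OF assms(2)]]
        bij_enumerate[OF assms(3)]] by blast
  let ?f = "\<lambda>x. if x \<in> C then \<theta> x else e x"
  have "bij_betw ?f C (\<theta> ` C)"
    using assms(1) by (subst bij_betw_cong[where g = \<theta>]) (auto simp: bij_betw_def)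
  moreover have "bij_betw ?f (- C) (- \<theta> ` C)"
    using e by (subst bij_betw_cong[where g = e]) auto
  ultimately have "bij_betw ?f (C \<union> - C) (\<theta> ` C \<union> - \<theta> ` C)"
    by (rule bij_betw_combine) simp
  then have "bij ?f" by (simp only: Compl_partition)
  then show ?thesis by (intro exI[where x = ?f]) simp
qed

text \<open>On \<open>C = - S \<union> g ` (- T)\<close> the map \<open>\<theta>\<close> is \<open>h\<close> on the first part, with values in \<open>T\<close>, and the inverse
  of \<open>g\<close> on the second, with values outside \<open>T\<close>. As \<open>S\<close> and \<open>T\<close> are unions of classes, elements of
  different parts are unrelated before and after applying \<open>\<theta>\<close>. The sets \<open>g ` T\<close> and \<open>h ` S\<close> remain free, so
  \<open>C\<close> and its image have infinite complements and \<open>\<theta>\<close> restricted to \<open>C\<close> extends to a bijection.\<close>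

lemma weakly_coarsely_computably_isomorphic_if_embeddings:
  assumes \<theta>: "computable_fun \<theta>"
    and dens: "has_density S 0" "has_density T 0"
    and closed: "\<And>x y. x \<in> S \<Longrightarrow> (x, y) \<in> A \<or> (y, x) \<in> A \<Longrightarrow> y \<in> S"
      "\<And>x y. x \<in> T \<Longrightarrow> (x, y) \<in> B \<or> (y, x) \<in> B \<Longrightarrow> y \<in> T"
    and h: "inj h" "range h \<subseteq> T" "\<And>x y. (h x, h y) \<in> B \<longleftrightarrow> (x, y) \<in> A"
    and g: "inj g" "range g \<subseteq> S" "\<And>x y. (g x, g y) \<in> A \<longleftrightarrow> (x, y) \<in> B"
    and inf: "infinite S" "infinite T"
    and \<theta>h: "\<And>x. x \<notin> S \<Longrightarrow> \<theta> x = h x"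
    and \<theta>g: "\<And>y. \<theta> (g y) = y"
  shows "weakly_coarsely_computably_isomorphic A B"
proof -
  define C where "C = - S \<union> g ` (- T)"
  have image: "\<theta> ` C = h ` (- S) \<union> - T"
    unfolding C_def image_Un image_image \<theta>g using \<theta>h by auto
  have cases: "(x \<notin> S \<and> \<theta> x = h x \<and> h x \<in> T) \<or> (\<exists>y. x = g y \<and> x \<in> S \<and> \<theta> x = y \<and> y \<notin> T)"
    if "x \<in> C" for x
    using that \<theta>h \<theta>g g(2) h(2) unfolding C_def by auto
  have inj: "inj_on \<theta> C"
  proof (rule inj_onI)
    fix x y assume "x \<in> C" "y \<in> C" "\<theta> x = \<theta> y"
    then show "x = y" using cases[of x] cases[of y] injD[OF h(1), of x y] by auto
  qed
  have rel: "(x, y) \<in> A \<longleftrightarrow> (\<theta> x, \<theta> y) \<in> B" if "x \<in> C" "y \<in> C" for x y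
    using cases[OF that(1)] cases[OF that(2)] h(3)[of x y] g(3) closed by metis
  have "g ` T \<subseteq> - C" unfolding C_def using g(1,2) by (auto dest: injD)
  moreover have "infinite (g ` T)" using inf(2) g(1) by (meson finite_imageD inj_on_subset subset_UNIV)
  ultimately have infC: "infinite (- C)" using infinite_super by blast
  have "h ` S \<subseteq> - \<theta> ` C" unfolding image using h(1,2) by (auto dest: injD)
  moreover have "infinite (h ` S)" using inf(1) h(1) by (meson finite_imageD inj_on_subset subset_UNIV)
  ultimately have "infinite (- \<theta> ` C)" using infinite_super by blast
  from inj_on_extends_to_bij[OF inj infC this]
  obtain f where f: "bij f" "\<forall>x\<in>C. f x = \<theta> x" by blast
  have "has_density C 1" by (rule has_density_one[OF dens(1)]) (simp add: C_def)
  moreover have "has_density (f ` C) 1"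
    by (rule has_density_one[OF dens(2)]) (use f(2) image in \<open>auto simp: image_def\<close>)
  moreover have "structure_iso C (Restr A C) (\<theta> ` C) (Restr B (\<theta> ` C)) \<theta>"
    unfolding structure_iso_def using inj rel by (auto simp: bij_betw_def)
  ultimately show ?thesis
    unfolding weakly_coarsely_computably_isomorphic_def using f \<theta> by blast
qed

theorem theorem4p15:
  fixes A B :: "(nat \<times> nat) set" and q :: real
  assumes "one_two_structure A" and "computable_rel A"
    and "one_two_structure B" and "computable_rel B"
    and "computable_real q"
    and "has_density (elements_of_class_size A 1) q"
    and "has_density (elements_of_class_size B 1) q"
  shows "weakly_coarsely_computably_isomorphic A B"
proof -
  interpret A: one_two A by unfold_locales (rule assms(1))
  interpret B: one_two B by unfold_locales (rule assms(3))
  define h where "h = embed A B (class_min A)"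
  define g where "g = embed B A B.pair_code"
  \<comment> \<open>On the sparse part of \<open>A\<close> this inverts \<open>g\<close> without checking that the argument is a value of \<open>g\<close>.\<close>
  define \<theta> where "\<theta> x =
      (if pair_index A x \<le> x then
         if lower A (pair_index A x) = x then smaller_coordinate (pair_index A x)
         else larger_coordinate (pair_index A x)
       else h x)" for x
  note h_emb = embed_related_iff[OF assms(1,3) A.class_min_eq_iff]
    inj_embed[OF assms(1,3) A.class_min_eq_iff]
  note g_emb = embed_related_iff[OF assms(3,1) B.pair_code_eq_iff]
    inj_embed[OF assms(3,1) B.pair_code_eq_iff]
  have "computable_fun \<theta>"
    unfolding \<theta>_def[abs_def] h_def embed_def
    by (intro computable_fun_if_binary computable_intros
        computable_binary_apply[OF computable_fun_smaller_coordinate]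
        computable_binary_apply[OF computable_fun_larger_coordinate]
        computable_binary_apply[OF A.computable_fun_pair_index[OF assms(2)]]
        computable_binary_apply[OF A.computable_fun_lower[OF assms(2)]]
        computable_binary_apply[OF A.computable_fun_class_min[OF assms(2)]]
        computable_binary_apply[OF B.computable_fun_lower[OF assms(4)]]
        computable_binary_apply[OF B.computable_fun_upper[OF assms(4)]])
  moreover have "\<theta> x = h x" if "x \<notin> sparse_part A" for x
    using that A.pair_index_le_iff unfolding \<theta>_def by simp
  moreover have "\<theta> (g y) = y" for y
  proof -
    have in_pair: "g y \<in> {lower A (B.pair_code y), upper A (B.pair_code y)}"
      unfolding g_def by (rule embed_in_pair)
    have index: "pair_index A (g y) = B.pair_code y" by (rule A.pair_index[OF in_pair])
    have le: "pair_index A (g y) \<le> g y"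
      unfolding A.pair_index_le_iff g_def by (rule embed_in_sparse_part)
    have lower: "lower A (B.pair_code y) = g y \<longleftrightarrow> class_min B y = y"
      using A.lower_less_upper[of "B.pair_code y"] unfolding g_def embed_def by simp
    show ?thesis
      using le lower B.smaller_coordinate_pair_code[of y] B.larger_coordinate_pair_code[of y]
      unfolding \<theta>_def index by simp
  qed
  moreover have "inj h" "range h \<subseteq> sparse_part B" "\<And>x y. (h x, h y) \<in> B \<longleftrightarrow> (x, y) \<in> A"
    unfolding h_def using h_emb embed_in_sparse_part by auto
  moreover have "inj g" "range g \<subseteq> sparse_part A" "\<And>x y. (g x, g y) \<in> A \<longleftrightarrow> (x, y) \<in> B"
    unfolding g_def using g_emb embed_in_sparse_part by auto
  moreover from this have "infinite (sparse_part A)"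
    by (meson infinite_super range_inj_infinite)
  moreover from calculation have "infinite (sparse_part B)"
    by (meson infinite_super range_inj_infinite)
  moreover have "y \<in> sparse_part A" if "x \<in> sparse_part A" "(x, y) \<in> A \<or> (y, x) \<in> A" for x y
    using that A.sparse_part_closed A.sym by blast
  moreover have "y \<in> sparse_part B" if "x \<in> sparse_part B" "(x, y) \<in> B \<or> (y, x) \<in> B" for x y
    using that B.sparse_part_closed B.sym by blast
  ultimately show ?thesis
    using A.sparse_part_density B.sparse_part_density
    by (intro weakly_coarsely_computably_isomorphic_if_embeddings[of \<theta> "sparse_part A"
          "sparse_part B" A B h g])
qed

end
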